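(* Let $(X,d)$ be a bounded metric space with more than one element, let $M>0$, and suppose $\theta=\frac{\sup d}{M}\le 2$. Let $F$, $F'$, $d_F$, $G=F'/\!\sim$ and $d_G$ be the associated objects. (1) $d_G$ agrees with the Hausdorff metric on finite subsets of $X$: for all non-empty finite $S,T\subseteq X$, if $[\hat S],[\hat T]\in G$ are the classes of $\hat S=\{1e_x:x\in S\}$ and $\hat T=\{1e_y:y\in T\}$, then $d_G([\hat S],[\hat T])=d_H(S,T)$. (2) If $d$ is uniformly discrete (i.e. there is $\alpha>0$ with $d(x,z)\ge\alpha$ whenever $x\ne z$), then $d_G$ is a complete metric on $G$. (3) For all $e,f\in F$ different from $\{e_0\}$, $d_F(e,f)\ge d_H(R(e),R(f))$.
   Context: $\mathbb{N}$ includes $0$. $A$ is the quotient of $X\times\mathbb{N}$ in which all points $(x,0)$, $x\in X$, are identified to a single point $e_0$; the class of $(x,r)$ is written $re_x$ (interpreted as $r$ copies of $x$), so $0e_x=e_0$. Define $d_A(re_x,te_z)=M|t-r|+\min(r,t)\,d(x,z)$ on $A$; it is a metric when $\theta=\frac{\sup d}{M}\le2$, where $\sup d=\sup_{x,y\in X}d(x,y)$. For a metric $\delta$ on $Y$ and non-empty finite $U,V\subseteq Y$, the Hausdorff metric is $\delta_H(U,V)=\max(\max_{u\in U}\min_{v\in V}\delta(u,v),\max_{v\in V}\min_{u\in U}\delta(u,v))$. $d_H$ is the Hausdorff metric from $d$ on non-empty finite subsets of $X$. $F'$ is the set consisting of $\{e_0\}$ together with all non-empty finite subsets of $A\setminus\{e_0\}$,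 and $d_F$ is the Hausdorff metric on $F'$ arising from $d_A$. $F\subseteq F'$ is the set of those $U\in F'$ such that $re_x,se_x\in U$ implies $r=s$ (these correspond to the finite multisets of $X$). For $U\in F'$ define $t_U:X\to\mathbb{N}$ by $t_U(x)=\sum_{ae_x\in U}a$ and the root set $R(U)=\{x\in X:t_U(x)>0\}$. Define $U\sim V$ iff $t_U=t_V$, and $G=F'/\!\sim$. The quotient pseudometric $d_G$ on $G$ is $$d_G(\alpha,\beta)=\inf\big(d_F(a,p_1)+d_F(q_1,p_2)+\dots+d_F(q_{n-1},p_n)+d_F(q_n,b)\big),$$ the infimum being over all $n\in\mathbb{N}$, $a\in\alpha$, $b\in\beta$ and $p_i,q_i\in F'$ with $p_i\sim q_i$ for $1\le i\le n$ (for $n=0$ the sum is $d_F(a,b)$). *)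

theory Defs
  imports "HOL-Analysis.Analysis"
begin

text \<open>
  A metric space is given by a carrier \<open>X\<close> and a distance \<open>d\<close>, as in the locale
  \<^locale>\<open>Metric_space\<close>.
\<close>

definition sup_dist :: "'a set \<Rightarrow> ('a \<Rightarrow> 'a \<Rightarrow> real) \<Rightarrow> real" where
  "sup_dist X d = (SUP (x, y) \<in> X \<times> X. d x y)"

text \<open>Only meaningful for finite non-empty sets, where the minima and maxima exist.\<close>

definition hausdorff :: "('b \<Rightarrow> 'b \<Rightarrow> real) \<Rightarrow> 'b set \<Rightarrow> 'b set \<Rightarrow> real" where
  "hausdorff \<delta> U V =
     max (MAX u\<in>U. MIN v\<in>V. \<delta> u v) (MAX v\<in>V. MIN u\<in>U. \<delta> u v)"


type_synonym 'a cone_pt = "('a \<times> nat) set"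

definition cone_rel :: "'a set \<Rightarrow> (('a \<times> nat) \<times> ('a \<times> nat)) set" where
  "cone_rel X = {((x, r), (z, t)). x \<in> X \<and> z \<in> X \<and> ((x, r) = (z, t) \<or> (r = 0 \<and> t = 0))}"

definition cone :: "'a set \<Rightarrow> 'a cone_pt set" where
  "cone X = (X \<times> UNIV) // cone_rel X"

text \<open>\<open>mult_pt X r x\<close> is the class \<open>r e\<^sub>x\<close> of \<open>(x, r)\<close>, and \<open>apex X\<close> is \<open>e\<^sub>0\<close>.\<close>

definition mult_pt :: "'a set \<Rightarrow> nat \<Rightarrow> 'a \<Rightarrow> 'a cone_pt" where
  "mult_pt X r x = cone_rel X `` {(x, r)}"

definition apex :: "'a set \<Rightarrow> 'a cone_pt" where
  "apex X = X \<times> {0}"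

text \<open>
  The value does not depend on the representatives; see \<open>cone_dist_mult_pt\<close> below.
\<close>

definition cone_dist ::
  "'a set \<Rightarrow> ('a \<Rightarrow> 'a \<Rightarrow> real) \<Rightarrow> real \<Rightarrow> 'a cone_pt \<Rightarrow> 'a cone_pt \<Rightarrow> real" where
  "cone_dist X d M a b =
     (THE v. \<exists>x\<in>X. \<exists>z\<in>X. \<exists>r t. a = mult_pt X r x \<and> b = mult_pt X t z \<and>
        v = M * \<bar>real t - real r\<bar> + real (min r t) * d x z)"


definition fin_sets :: "'a set \<Rightarrow> 'a cone_pt set set" where
  "fin_sets X = {{apex X}} \<union> {U. finite U \<and> U \<noteq> {} \<and> U \<subseteq> cone X - {apex X}}"

definition multisets :: "'a set \<Rightarrow> 'a cone_pt set set" where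
  "multisets X =
     {U \<in> fin_sets X. \<forall>x\<in>X. \<forall>r s. mult_pt X r x \<in> U \<and> mult_pt X s x \<in> U \<longrightarrow> r = s}"

definition fin_dist ::
  "'a set \<Rightarrow> ('a \<Rightarrow> 'a \<Rightarrow> real) \<Rightarrow> real \<Rightarrow> 'a cone_pt set \<Rightarrow> 'a cone_pt set \<Rightarrow> real" where
  "fin_dist X d M = hausdorff (cone_dist X d M)"

definition total_mult :: "'a set \<Rightarrow> 'a cone_pt set \<Rightarrow> 'a \<Rightarrow> nat" where
  "total_mult X U x = (\<Sum>a | mult_pt X a x \<in> U. a)"

definition root_set :: "'a set \<Rightarrow> 'a cone_pt set \<Rightarrow> 'a set" where
  "root_set X U = {x \<in> X. total_mult X U x > 0}"


definition same_mult :: "'a set \<Rightarrow> ('a cone_pt set \<times> 'a cone_pt set) set" where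
  "same_mult X =
     {(U, V). U \<in> fin_sets X \<and> V \<in> fin_sets X \<and>
        (\<forall>x\<in>X. total_mult X U x = total_mult X V x)}"

definition mult_quot :: "'a set \<Rightarrow> 'a cone_pt set set set" where
  "mult_quot X = fin_sets X // same_mult X"

definition mult_class :: "'a set \<Rightarrow> 'a cone_pt set \<Rightarrow> 'a cone_pt set set" where
  "mult_class X U = same_mult X `` {U}"

text \<open>
  The length of the chain \<open>a, p\<^sub>1 \<sim> q\<^sub>1, \<dots>, p\<^sub>n \<sim> q\<^sub>n, b\<close>.
  Only the values of \<open>p\<close> and \<open>q\<close> at \<open>1, \<dots>, n\<close> are used.
\<close>

definition chain_length ::
  "('b \<Rightarrow> 'b \<Rightarrow> real) \<Rightarrow> nat \<Rightarrow> 'b \<Rightarrow> (nat \<Rightarrow> 'b) \<Rightarrow> (nat \<Rightarrow> 'b) \<Rightarrow> 'b \<Rightarrow> real" where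
  "chain_length \<delta> n a p q b =
     (if n = 0 then \<delta> a b
      else \<delta> a (p 1) + (\<Sum>i = 1..<n. \<delta> (q i) (p (Suc i))) + \<delta> (q n) b)"

text \<open>
  The value \<open>0\<close> outside the quotient is a convention: \<^locale>\<open>Metric_space\<close> asks for
  nonnegativity and symmetry on the whole type, not only on the carrier.
\<close>

definition quot_dist ::
  "'a set \<Rightarrow> ('a \<Rightarrow> 'a \<Rightarrow> real) \<Rightarrow> real
    \<Rightarrow> 'a cone_pt set set \<Rightarrow> 'a cone_pt set set \<Rightarrow> real" where
  "quot_dist X d M \<alpha> \<beta> =
     (if \<alpha> \<in> mult_quot X \<and> \<beta> \<in> mult_quot X
      then Inf {chain_length (fin_dist X d M) n a p q b | n a b p q.
                  a \<in> \<alpha> \<and> b \<in> \<beta> \<and> (\<forall>i\<in>{1..n}. (p i, q i) \<in> same_mult X)}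
      else 0)"


lemma mult_pt_eq_iff:
  assumes "x \<in> X" "z \<in> X"
  shows "mult_pt X r x = mult_pt X t z \<longleftrightarrow> (x, r) = (z, t) \<or> (r = 0 \<and> t = 0)"
  using assms unfolding mult_pt_def cone_rel_def by (auto simp: set_eq_iff)

lemma mult_pt_0: "x \<in> X \<Longrightarrow> mult_pt X 0 x = apex X"
  unfolding mult_pt_def cone_rel_def apex_def by auto

lemma cone_eq: "cone X = {mult_pt X r x | r x. x \<in> X}"
  unfolding cone_def mult_pt_def quotient_def by auto

lemma equiv_cone_rel: "equiv (X \<times> UNIV) (cone_rel X)"
  by (rule equivI) (auto simp: cone_rel_def refl_on_def sym_def trans_def)

lemma equiv_same_mult: "equiv (fin_sets X) (same_mult X)"
  by (rule equivI) (auto simp: same_mult_def refl_on_def sym_def trans_def)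

lemma cone_dist_mult_pt:
  assumes "x \<in> X" "z \<in> X"
  shows "cone_dist X d M (mult_pt X r x) (mult_pt X t z) =
           M * \<bar>real t - real r\<bar> + real (min r t) * d x z"
  unfolding cone_dist_def
proof (rule the_equality)
  show "\<exists>x'\<in>X. \<exists>z'\<in>X. \<exists>r' t'. mult_pt X r x = mult_pt X r' x' \<and> mult_pt X t z = mult_pt X t' z' \<and>
          M * \<bar>real t - real r\<bar> + real (min r t) * d x z =
          M * \<bar>real t' - real r'\<bar> + real (min r' t') * d x' z'"
    using assms by blast
next
  fix v
  assume "\<exists>x'\<in>X. \<exists>z'\<in>X. \<exists>r' t'. mult_pt X r x = mult_pt X r' x' \<and> mult_pt X t z = mult_pt X t' z' \<and>
            v = M * \<bar>real t' - real r'\<bar> + real (min r' t') * d x' z'"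
  then obtain x' z' r' t' where *: "x' \<in> X" "z' \<in> X"
    "mult_pt X r x = mult_pt X r' x'" "mult_pt X t z = mult_pt X t' z'"
    "v = M * \<bar>real t' - real r'\<bar> + real (min r' t') * d x' z'"
    by blast
  show "v = M * \<bar>real t - real r\<bar> + real (min r t) * d x z"
    using *(3-5) mult_pt_eq_iff[OF assms(1) *(1), of r r'] mult_pt_eq_iff[OF assms(2) *(2), of t t']
    by auto
qed

lemma finite_mult_index:
  assumes "U \<in> fin_sets X" "x \<in> X"
  shows "finite {a. mult_pt X a x \<in> U}"
proof -
  have "finite U" using assms unfolding fin_sets_def by auto
  moreover have "inj (\<lambda>a. mult_pt X a x)"
    using assms by (auto simp: inj_def mult_pt_eq_iff)
  ultimately show ?thesis
    by (simp add: finite_vimageI[of U, unfolded vimage_def])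
qed

end

theory Submission
  imports Defs
begin

text \<open>
  Any pseudometric on \<open>F'\<close> that is invariant under \<open>\<sim>\<close> and bounded above by \<open>d\<^sub>F\<close> is also
  bounded above by \<open>d\<^sub>G\<close>. For (1) and (3) take the Hausdorff distance of the root sets, where
  the empty root set (that of \<open>{e\<^sub>0}\<close>) is put at distance \<open>M\<close> from all others; the triangle
  inequality through the empty set is exactly \<open>\<theta> \<le> 2\<close>. For (2) take a multiple of the
  discrete metric on classes: in the uniformly discrete case \<open>d\<^sub>A\<close>, hence \<open>d\<^sub>F\<close>, hence \<open>d\<^sub>G\<close>, is
  uniformly discrete, and Cauchy sequences are eventually constant.
\<close>

section \<open>Hausdorff distance of finite sets\<close>

text \<open>Unwinds the maxima and minima into near matches in both directions. Taking
  \<open>c\<close> to be the Hausdorff distance itself gives \<open>hausdorff_left\<close> and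
  \<open>hausdorff_right\<close>, which supply nearest points.\<close>

lemma hausdorff_le_iff:
  assumes "finite U" "U \<noteq> {}" "finite V" "V \<noteq> {}"
  shows "hausdorff \<delta> U V \<le> c \<longleftrightarrow>
    (\<forall>u\<in>U. \<exists>v\<in>V. \<delta> u v \<le> c) \<and> (\<forall>v\<in>V. \<exists>u\<in>U. \<delta> u v \<le> c)"
  using assms by (simp add: hausdorff_def Min_le_iff)

lemma hausdorff_left:
  assumes "finite U" "finite V" "V \<noteq> {}" "u \<in> U"
  obtains v where "v \<in> V" "\<delta> u v \<le> hausdorff \<delta> U V"
  using hausdorff_le_iff[of U V \<delta> "hausdorff \<delta> U V"] assms by blast

lemma hausdorff_right:
  assumes "finite U" "finite V" "U \<noteq> {}" "v \<in> V"
  obtains u where "u \<in> U" "\<delta> u v \<le> hausdorff \<delta> U V"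
  using hausdorff_le_iff[of U V \<delta> "hausdorff \<delta> U V"] assms by blast

lemma hausdorff_nonneg:
  assumes "finite U" "U \<noteq> {}" "finite V" "V \<noteq> {}" "\<And>u v. u \<in> U \<Longrightarrow> v \<in> V \<Longrightarrow> 0 \<le> \<delta> u v"
  shows "0 \<le> hausdorff \<delta> U V"
proof -
  obtain u where "u \<in> U" using assms by blast
  then obtain v where "v \<in> V" "\<delta> u v \<le> hausdorff \<delta> U V"
    using hausdorff_left assms by metis
  then show ?thesis using assms(5) \<open>u \<in> U\<close> by force
qed

lemma hausdorff_commute:
  assumes "\<And>u v. u \<in> U \<Longrightarrow> v \<in> V \<Longrightarrow> \<delta> u v = \<delta> v u"
  shows "hausdorff \<delta> U V = hausdorff \<delta> V U"
proof -
  have "(\<lambda>u. MIN v\<in>V. \<delta> u v) ` U = (\<lambda>u. MIN v\<in>V. \<delta> v u) ` U"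
    using assms by (intro image_cong refl arg_cong[of _ _ Min]) auto
  moreover have "(\<lambda>v. MIN u\<in>U. \<delta> u v) ` V = (\<lambda>v. MIN u\<in>U. \<delta> v u) ` V"
    using assms by (intro image_cong refl arg_cong[of _ _ Min]) auto
  ultimately show ?thesis by (simp add: hausdorff_def max.commute)
qed

text \<open>Nearest points are composed through \<open>V\<close>. From \<open>u\<close> the walk
  goes \<open>U\<close>, \<open>V\<close>, \<open>W\<close>; from \<open>w\<close> it goes
  backwards, so \<open>tri\<close> is applied in the same orientation both times.\<close>

lemma hausdorff_triangle:
  assumes fin: "finite U" "U \<noteq> {}" "finite V" "V \<noteq> {}" "finite W" "W \<noteq> {}"
    and tri: "\<And>u v w. u \<in> U \<Longrightarrow> v \<in> V \<Longrightarrow> w \<in> W \<Longrightarrow> \<delta> u w \<le> \<delta> u v + \<delta> v w"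
  shows "hausdorff \<delta> U W \<le> hausdorff \<delta> U V + hausdorff \<delta> V W"
proof -
  have "\<exists>w\<in>W. \<delta> u w \<le> hausdorff \<delta> U V + hausdorff \<delta> V W" if u: "u \<in> U" for u
  proof -
    obtain v where v: "v \<in> V" "\<delta> u v \<le> hausdorff \<delta> U V"
      using hausdorff_left[of U V u \<delta>] fin u by metis
    obtain w where "w \<in> W" "\<delta> v w \<le> hausdorff \<delta> V W"
      using hausdorff_left[of V W v \<delta>] fin v by metis
    then show ?thesis using v u tri[of u v w] by force
  qed
  moreover have "\<exists>u\<in>U. \<delta> u w \<le> hausdorff \<delta> U V + hausdorff \<delta> V W" if w: "w \<in> W" for w
  proof -
    obtain v where v: "v \<in> V" "\<delta> v w \<le> hausdorff \<delta> V W"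
      using hausdorff_right[of V W w \<delta>] fin w by metis
    obtain u where "u \<in> U" "\<delta> u v \<le> hausdorff \<delta> U V"
      using hausdorff_right[of U V v \<delta>] fin v by metis
    then show ?thesis using v w tri[of u v w] by force
  qed
  ultimately show ?thesis using fin by (simp add: hausdorff_le_iff)
qed

lemma hausdorff_self:
  assumes "finite U" "U \<noteq> {}" "\<And>u v. u \<in> U \<Longrightarrow> v \<in> U \<Longrightarrow> 0 \<le> \<delta> u v" "\<And>u. u \<in> U \<Longrightarrow> \<delta> u u = 0"
  shows "hausdorff \<delta> U U = 0"
proof (rule antisym)
  show "hausdorff \<delta> U U \<le> 0"
    using assms by (simp add: hausdorff_le_iff) (metis order.refl)
qed (use assms hausdorff_nonneg in metis)

text \<open>Below \<open>\<epsilon>\<close> a near match must be the point itself, so each set would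
  contain the other.\<close>

lemma hausdorff_uniformly_discrete:
  assumes "finite U" "U \<noteq> {}" "finite V" "V \<noteq> {}" "U \<noteq> V"
    and "\<And>u v. u \<in> U \<Longrightarrow> v \<in> V \<Longrightarrow> u \<noteq> v \<Longrightarrow> \<epsilon> \<le> \<delta> u v"
  shows "\<epsilon> \<le> hausdorff \<delta> U V"
proof (rule ccontr)
  assume "\<not> ?thesis"
  then have less: "hausdorff \<delta> U V < \<epsilon>" by simp
  have "u \<in> V" if u: "u \<in> U" for u
  proof -
    obtain v where "v \<in> V" "\<delta> u v \<le> hausdorff \<delta> U V"
      using hausdorff_left[of U V u \<delta>] assms u by metis
    then show ?thesis using assms(6)[of u v] u less by force
  qed
  moreover have "v \<in> U" if v: "v \<in> V" for v
  proof -
    obtain u where "u \<in> U" "\<delta> u v \<le> hausdorff \<delta> U V"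
      using hausdorff_right[of U V v \<delta>] assms v by metis
    then show ?thesis using assms(6)[of u v] v less by force
  qed
  ultimately show False using assms by blast
qed

lemma hausdorff_image:
  assumes "\<And>s t. s \<in> S \<Longrightarrow> t \<in> T \<Longrightarrow> \<delta> (f s) (f t) = d s t"
  shows "hausdorff \<delta> (f ` S) (f ` T) = hausdorff d S T"
proof -
  have "(\<lambda>s. MIN t\<in>T. \<delta> (f s) (f t)) ` S = (\<lambda>s. MIN t\<in>T. d s t) ` S"
    using assms by (intro image_cong refl arg_cong[of _ _ Min]) auto
  moreover have "(\<lambda>t. MIN s\<in>S. \<delta> (f s) (f t)) ` T = (\<lambda>t. MIN s\<in>S. d s t) ` T"
    using assms by (intro image_cong refl arg_cong[of _ _ Min]) auto
  ultimately show ?thesis by (simp add: hausdorff_def image_image)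
qed

section \<open>Chains\<close>

text \<open>Chains with their length as an index, grown at the right end: the old endpoint
  \<open>p\<close> is glued to \<open>q\<close>, and a leg from \<open>q\<close> to \<open>b\<close>
  is added. This turns statements about \<open>chain_length\<close> into rule inductions.\<close>

inductive glue_chain ::
  "('b \<times> 'b) set \<Rightarrow> ('b \<Rightarrow> 'b \<Rightarrow> real) \<Rightarrow> 'b \<Rightarrow> 'b \<Rightarrow> real \<Rightarrow> bool"
  for E \<delta> where
    direct: "glue_chain E \<delta> a b (\<delta> a b)"
  | snoc: "glue_chain E \<delta> a p L \<Longrightarrow> (p, q) \<in> E \<Longrightarrow> glue_chain E \<delta> a b (L + \<delta> q b)"

text \<open>The analogue of \<open>snoc\<close>: the shorter chain ends at \<open>p (Suc n)\<close>,
  the point about to be glued.\<close>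

lemma chain_length_Suc:
  "chain_length \<delta> (Suc n) a p q b = chain_length \<delta> n a p q (p (Suc n)) + \<delta> (q (Suc n)) b"
  by (cases n) (auto simp: chain_length_def)

lemma chain_length_cong:
  assumes "\<And>i. i \<in> {1..n} \<Longrightarrow> p i = p' i \<and> q i = q' i"
  shows "chain_length \<delta> n a p q b = chain_length \<delta> n a p' q' b"
proof -
  have "(\<Sum>i = 1..<n. \<delta> (q i) (p (Suc i))) = (\<Sum>i = 1..<n. \<delta> (q' i) (p' (Suc i)))"
    using assms by (intro sum.cong) auto
  then show ?thesis
    using assms[of 1] assms[of n] by (auto simp: chain_length_def)
qed

lemma glue_chain_chain_length:
  assumes "\<forall>i\<in>{1..n}. (p i, q i) \<in> E"
  shows "glue_chain E \<delta> a b (chain_length \<delta> n a p q b)"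
  using assms
proof (induction n arbitrary: b)
  case 0
  show ?case by (simp add: chain_length_def glue_chain.direct)
next
  case (Suc n)
  then show ?case unfolding chain_length_Suc by (intro glue_chain.snoc) auto
qed

lemma glue_chain_iff:
  "glue_chain E \<delta> a b L \<longleftrightarrow>
    (\<exists>n p q. L = chain_length \<delta> n a p q b \<and> (\<forall>i\<in>{1..n}. (p i, q i) \<in> E))"
proof
  assume "glue_chain E \<delta> a b L"
  then show "\<exists>n p q. L = chain_length \<delta> n a p q b \<and> (\<forall>i\<in>{1..n}. (p i, q i) \<in> E)"
  proof induction
    case (direct a b)
    show ?case by (intro exI[of _ 0]) (simp add: chain_length_def)
  next
    case (snoc a r L s b)
    then obtain n p q where L: "L = chain_length \<delta> n a p q r" "\<forall>i\<in>{1..n}. (p i, q i) \<in> E"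
      by blast
    \<comment> \<open>Position \<open>Suc n\<close> lies outside the range read by the shorter
      chain, so it is free to hold the new glued pair.\<close>
    let ?p = "p(Suc n := r)" and ?q = "q(Suc n := s)"
    have "chain_length \<delta> n a ?p ?q r = L"
      unfolding L by (rule chain_length_cong) auto
    then have "L + \<delta> s b = chain_length \<delta> (Suc n) a ?p ?q b"
      by (simp add: chain_length_Suc)
    moreover have "\<forall>i\<in>{1..Suc n}. (?p i, ?q i) \<in> E"
      using L snoc.hyps by (auto simp: le_Suc_eq)
    ultimately show ?case by blast
  qed
qed (auto intro: glue_chain_chain_length)

text \<open>Induction on the second chain, since chains grow at the right; the gluing of
  \<open>p\<close> to \<open>q\<close> is used up in the base case.\<close>

lemma glue_chain_append:
  assumes "glue_chain E \<delta> q c L'" "glue_chain E \<delta> a p L" "(p, q) \<in> E"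
  shows "glue_chain E \<delta> a c (L + L')"
  using assms
proof (induction arbitrary: p)
  case (direct q c)
  then show ?case by (blast intro: glue_chain.snoc)
next
  case (snoc q r L' s c)
  then have "glue_chain E \<delta> a r (L + L')" by blast
  then show ?case using snoc.hyps glue_chain.snoc by (metis add.assoc)
qed

text \<open>The last leg, reversed, becomes the first; the reversed remainder is appended to it
  across \<open>(q, p)\<close>, available by symmetry of \<open>E\<close>.\<close>

lemma glue_chain_sym:
  assumes "glue_chain E \<delta> a b L" "a \<in> F" "b \<in> F" "equiv F E"
    and "\<And>x y. x \<in> F \<Longrightarrow> y \<in> F \<Longrightarrow> \<delta> x y = \<delta> y x"
  shows "glue_chain E \<delta> b a L"
  using assms(1-3)
proof induction
  case (direct a b)
  then show ?case using glue_chain.direct[of E \<delta> b a] assms(5) by simp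
next
  case (snoc a p L q b)
  have "p \<in> F" "q \<in> F" "(q, p) \<in> E"
    using snoc.hyps assms(4) by (auto simp: equiv_def sym_def)
  then show ?case
    using glue_chain_append[of E \<delta> p a L b q "\<delta> b q"] glue_chain.direct[of E \<delta> b q] snoc assms(5)
    by (simp add: add.commute)
qed

text \<open>Legs cost at least their \<open>\<rho>\<close> and gluings have no positive
  \<open>\<rho>\<close>, so the triangle inequality telescopes along the chain. It is applied below
  to the zero function, to the distance of root sets, and to a multiple of the discrete metric on
  classes.\<close>

lemma glue_chain_lower_bound:
  assumes "glue_chain E \<delta> a b L" "a \<in> F" "b \<in> F" "E \<subseteq> F \<times> F"
    and "\<And>x y. x \<in> F \<Longrightarrow> y \<in> F \<Longrightarrow> \<rho> x y \<le> \<delta> x y"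
    and "\<And>x y z. x \<in> F \<Longrightarrow> y \<in> F \<Longrightarrow> z \<in> F \<Longrightarrow> \<rho> x z \<le> \<rho> x y + \<rho> y z"
    and "\<And>x y. (x, y) \<in> E \<Longrightarrow> \<rho> x y \<le> 0"
  shows "\<rho> a b \<le> L"
  using assms(1-3)
proof induction
  case (direct a b)
  then show ?case using assms(5) by blast
next
  case (snoc a p L q b)
  have "p \<in> F" "q \<in> F" using snoc.hyps assms(4) by auto
  then have "\<rho> a b \<le> \<rho> a p + \<rho> p b" "\<rho> p b \<le> \<rho> p q + \<rho> q b" "\<rho> q b \<le> \<delta> q b" "\<rho> a p \<le> L"
    using snoc assms(5,6) by blast+
  then show ?case using assms(7)[OF snoc.hyps(2)] by linarith
qed

section \<open>Finite sets in the cone and their root sets\<close>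

lemma mult_pt_pos: "x \<in> X \<Longrightarrow> 0 < r \<Longrightarrow> mult_pt X r x = {(x, r)}"
  by (auto simp: mult_pt_def cone_rel_def)

lemma apex_in_cone: "x \<in> X \<Longrightarrow> apex X \<in> cone X"
  using mult_pt_0[of x X] by (auto simp: cone_eq)

lemma fin_setsD:
  assumes "U \<in> fin_sets X"
  shows "finite U" "U \<noteq> {}"
  using assms by (auto simp: fin_sets_def)

lemma fin_sets_subset_cone:
  assumes "U \<in> fin_sets X" "X \<noteq> {}"
  shows "U \<subseteq> cone X"
  using assms apex_in_cone by (fastforce simp: fin_sets_def)

lemma fin_sets_cases:
  assumes "U \<in> fin_sets X" "U \<noteq> {apex X}" "u \<in> U"
  obtains r x where "x \<in> X" "0 < r" "u = mult_pt X r x"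
proof -
  have "u \<in> cone X" "u \<noteq> apex X" using assms by (auto simp: fin_sets_def)
  then obtain r x where "x \<in> X" "u = mult_pt X r x" by (auto simp: cone_eq)
  with \<open>u \<noteq> apex X\<close> that show ?thesis by (cases "r = 0") (auto simp: mult_pt_0)
qed

text \<open>A sum of naturals is positive iff some summand is. Finiteness of the index set matters,
  because \<open>sum\<close> over an infinite set is 0 by convention.\<close>

lemma in_root_set_iff:
  assumes "U \<in> fin_sets X"
  shows "x \<in> root_set X U \<longleftrightarrow> x \<in> X \<and> (\<exists>r>0. mult_pt X r x \<in> U)"
proof (cases "x \<in> X")
  case True
  have "finite {a. mult_pt X a x \<in> U}" using finite_mult_index assms True .
  then show ?thesis using True by (auto simp: root_set_def total_mult_def simp flip: neq0_conv)
qed (simp add: root_set_def)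

lemma root_set_subset: "root_set X U \<subseteq> X"
  by (auto simp: root_set_def)

lemma finite_root_set:
  assumes "U \<in> fin_sets X"
  shows "finite (root_set X U)"
proof (rule finite_subset)
  \<comment> \<open>Off the apex a class is a singleton \<open>{(x, r)}\<close>, from which the root
    \<open>x\<close> can be read. Whatever value the apex yields is harmless for an
    inclusion.\<close>
  show "root_set X U \<subseteq> (\<lambda>u. fst (the_elem u)) ` U"
  proof
    fix x assume "x \<in> root_set X U"
    then obtain r where "x \<in> X" "0 < r" "mult_pt X r x \<in> U"
      using in_root_set_iff assms by metis
    then show "x \<in> (\<lambda>u. fst (the_elem u)) ` U"
      by (intro image_eqI[of _ _ "mult_pt X r x"]) (auto simp: mult_pt_pos)
  qed
qed (use fin_setsD assms in auto)

lemma root_set_empty_iff: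
  assumes "U \<in> fin_sets X"
  shows "root_set X U = {} \<longleftrightarrow> U = {apex X}"
proof
  assume "root_set X U = {}"
  moreover obtain u where "u \<in> U" using fin_setsD(2)[OF assms] by blast
  ultimately show "U = {apex X}"
    using fin_sets_cases[OF assms _ \<open>u \<in> U\<close>] in_root_set_iff[OF assms] by (metis empty_iff)
next
  assume "U = {apex X}"
  then show "root_set X U = {}"
    using in_root_set_iff[OF assms] by (fastforce simp: mult_pt_pos apex_def)
qed

text \<open>Makes every distance between root sets invariant under gluing.\<close>

lemma same_mult_root_set: "(U, V) \<in> same_mult X \<Longrightarrow> root_set X U = root_set X V"
  by (auto simp: same_mult_def root_set_def)

lemma mult_pt_1_image_in_fin_sets:
  assumes "finite S" "S \<noteq> {}" "S \<subseteq> X"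
  shows "mult_pt X 1 ` S \<in> fin_sets X"
proof -
  have "mult_pt X 1 x \<in> cone X - {apex X}" if "x \<in> S" for x
    using that assms mult_pt_pos[of x X 1] by (auto simp: cone_eq apex_def)
  then show ?thesis using assms by (auto simp: fin_sets_def)
qed

lemma root_set_mult_pt_1_image:
  assumes "finite S" "S \<noteq> {}" "S \<subseteq> X"
  shows "root_set X (mult_pt X 1 ` S) = S"
proof (rule set_eqI)
  fix x
  have "(\<exists>r>0. mult_pt X r x \<in> mult_pt X 1 ` S) \<longleftrightarrow> x \<in> S" if "x \<in> X"
    using that assms(3) by (force simp: image_iff mult_pt_eq_iff subset_iff)
  then show "x \<in> root_set X (mult_pt X 1 ` S) \<longleftrightarrow> x \<in> S"
    using in_root_set_iff[OF mult_pt_1_image_in_fin_sets[OF assms]] assms(3) by blast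
qed

lemma mult_quot_subset:
  assumes "\<alpha> \<in> mult_quot X" "a \<in> \<alpha>"
  shows "a \<in> fin_sets X"
  using assms by (auto simp: mult_quot_def quotient_def same_mult_def)

text \<open>\<open>diam\<close> is the condition \<open>\<theta> \<le> 2\<close> with the supremum
  and the division removed.\<close>

locale bounded_cone = Metric_space X d for X :: "'a set" and d +
  fixes M :: real
  assumes nonempty: "X \<noteq> {}"
    and M_pos: "0 < M"
    and diam: "\<And>x y. x \<in> X \<Longrightarrow> y \<in> X \<Longrightarrow> d x y \<le> 2 * M"
begin

abbreviation "d\<^sub>A \<equiv> cone_dist X d M"
abbreviation "d\<^sub>F \<equiv> fin_dist X d M"
abbreviation "d\<^sub>G \<equiv> quot_dist X d M"

section \<open>Elementary properties of \<open>d\<^sub>A\<close> and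
  \<open>d\<^sub>F\<close>\<close>

lemma cone_dist_nonneg:
  assumes "a \<in> cone X" "b \<in> cone X"
  shows "0 \<le> d\<^sub>A a b"
  using assms M_pos by (auto simp: cone_eq cone_dist_mult_pt)

lemma cone_dist_commute:
  assumes "a \<in> cone X" "b \<in> cone X"
  shows "d\<^sub>A a b = d\<^sub>A b a"
  using assms by (auto simp: cone_eq cone_dist_mult_pt commute min.commute abs_minus_commute)

lemma cone_dist_self: "a \<in> cone X \<Longrightarrow> d\<^sub>A a a = 0"
  by (auto simp: cone_eq cone_dist_mult_pt)

lemma fin_dist_nonneg:
  assumes "U \<in> fin_sets X" "V \<in> fin_sets X"
  shows "0 \<le> d\<^sub>F U V"
  unfolding fin_dist_def
  using assms[THEN fin_sets_subset_cone, OF nonempty]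
  by (intro hausdorff_nonneg fin_setsD[OF assms(1)] fin_setsD[OF assms(2)] cone_dist_nonneg) auto

lemma fin_dist_commute:
  assumes "U \<in> fin_sets X" "V \<in> fin_sets X"
  shows "d\<^sub>F U V = d\<^sub>F V U"
  unfolding fin_dist_def
  using assms[THEN fin_sets_subset_cone, OF nonempty]
  by (intro hausdorff_commute cone_dist_commute) auto

lemma fin_dist_self:
  assumes "U \<in> fin_sets X"
  shows "d\<^sub>F U U = 0"
  unfolding fin_dist_def
  using fin_sets_subset_cone[OF assms nonempty]
  by (intro hausdorff_self fin_setsD[OF assms] cone_dist_nonneg cone_dist_self) auto

section \<open>The distance of root sets\<close>

text \<open>Away from the apex both multiplicities are at least 1, so the factor
  \<open>min r t\<close> only enlarges \<open>d x z\<close>. Near matches in the cone therefore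
  project to near matches of roots.\<close>

lemma hausdorff_root_set_le_fin_dist:
  assumes "U \<in> fin_sets X" "V \<in> fin_sets X" "U \<noteq> {apex X}" "V \<noteq> {apex X}"
  shows "hausdorff d (root_set X U) (root_set X V) \<le> d\<^sub>F U V"
proof -
  have le: "d x z \<le> d\<^sub>A (mult_pt X r x) (mult_pt X t z)"
    if "x \<in> X" "z \<in> X" "0 < r" "0 < t" for x z r t
  proof -
    have "1 * d x z \<le> real (min r t) * d x z" using that by (intro mult_right_mono) auto
    moreover have "0 \<le> M * \<bar>real t - real r\<bar>" using M_pos by simp
    ultimately show ?thesis using that by (simp add: cone_dist_mult_pt)
  qed
  have "\<exists>z\<in>root_set X V. d x z \<le> d\<^sub>F U V" if x: "x \<in> root_set X U" for x
  proof -
    obtain r where r: "x \<in> X" "0 < r" "mult_pt X r x \<in> U"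
      using x by (auto simp: in_root_set_iff[OF assms(1)])
    obtain v where v: "v \<in> V" "d\<^sub>A (mult_pt X r x) v \<le> d\<^sub>F U V"
      using hausdorff_left[OF fin_setsD(1)[OF assms(1)] fin_setsD[OF assms(2)] r(3), of d\<^sub>A]
      unfolding fin_dist_def by blast
    obtain t z where "z \<in> X" "0 < t" "v = mult_pt X t z"
      using fin_sets_cases[OF assms(2,4) v(1)] by blast
    then show ?thesis using v r le[of x z r t] in_root_set_iff[OF assms(2), of z] by force
  qed
  moreover have "\<exists>x\<in>root_set X U. d x z \<le> d\<^sub>F U V" if z: "z \<in> root_set X V" for z
  proof -
    obtain t where t: "z \<in> X" "0 < t" "mult_pt X t z \<in> V"
      using z by (auto simp: in_root_set_iff[OF assms(2)])
    obtain u where u: "u \<in> U" "d\<^sub>A u (mult_pt X t z) \<le> d\<^sub>F U V"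
      using hausdorff_right[OF fin_setsD(1)[OF assms(1)] fin_setsD(1)[OF assms(2)]
          fin_setsD(2)[OF assms(1)] t(3), of d\<^sub>A]
      unfolding fin_dist_def by blast
    obtain r x where "x \<in> X" "0 < r" "u = mult_pt X r x"
      using fin_sets_cases[OF assms(1,3) u(1)] by blast
    then show ?thesis using u t le[of x z r t] in_root_set_iff[OF assms(1), of x] by force
  qed
  ultimately show ?thesis
    using assms by (simp add: hausdorff_le_iff finite_root_set root_set_empty_iff)
qed

lemma M_le_fin_dist_apex:
  assumes "V \<in> fin_sets X" "V \<noteq> {apex X}"
  shows "M \<le> d\<^sub>F {apex X} V"
proof -
  obtain v where v: "v \<in> V" using assms fin_setsD by blast
  obtain t z where t: "z \<in> X" "0 < t" "v = mult_pt X t z"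
    using fin_sets_cases[OF assms v] by blast
  have "M * 1 \<le> M * real t" using t M_pos by (intro mult_left_mono) auto
  \<comment> \<open>The apex is represented as 0 copies of the same root \<open>z\<close>, which
    leaves only the term in \<open>M\<close>.\<close>
  also have "\<dots> = d\<^sub>A (apex X) v"
    using t cone_dist_mult_pt[of z X z d M 0 t] by (simp add: mult_pt_0)
  also have "\<dots> \<le> d\<^sub>F {apex X} V"
    using hausdorff_right[of "{apex X}" V v d\<^sub>A] v fin_setsD(1)[OF assms(1)]
    unfolding fin_dist_def by blast
  finally show ?thesis by simp
qed

text \<open>The Hausdorff distance extended to the empty set, the root set of
  \<open>{apex X}\<close>; nothing is truncated. The value \<open>M\<close> is small enough for
  \<open>M_le_fin_dist_apex\<close> and, by \<open>diam\<close>, large enough for the triangle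
  inequality.\<close>

definition capped_hausdorff :: "'a set \<Rightarrow> 'a set \<Rightarrow> real" where
  "capped_hausdorff S T =
     (if S = {} \<or> T = {} then if S = T then 0 else M else hausdorff d S T)"

lemma capped_hausdorff_self: "finite S \<Longrightarrow> S \<subseteq> X \<Longrightarrow> capped_hausdorff S S = 0"
  by (auto simp: capped_hausdorff_def intro!: hausdorff_self)

lemma capped_hausdorff_triangle:
  assumes S: "finite S" "S \<subseteq> X" and T: "finite T" "T \<subseteq> X" and U: "finite U" "U \<subseteq> X"
  shows "capped_hausdorff S U \<le> capped_hausdorff S T + capped_hausdorff T U"
proof -
  have nonneg: "0 \<le> hausdorff d V W"
    if "finite V" "V \<noteq> {}" "finite W" "W \<noteq> {}" for V W
    using that by (intro hausdorff_nonneg) auto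
  consider "S = {} \<or> U = {}" | "S \<noteq> {}" "U \<noteq> {}" "T = {}" | "S \<noteq> {}" "T \<noteq> {}" "U \<noteq> {}"
    by blast
  then show ?thesis
  proof cases
    case 1
    then show ?thesis using M_pos nonneg S T U by (auto simp: capped_hausdorff_def)
  next
    case 2
    \<comment> \<open>The detour through the empty set costs \<open>M + M\<close>; this is where
      \<open>diam\<close> enters.\<close>
    then have "hausdorff d S U \<le> 2 * M"
      using S U diam by (auto simp: hausdorff_le_iff) (meson all_not_in_conv subsetD)+
    then show ?thesis using 2 by (simp add: capped_hausdorff_def)
  next
    case 3
    then have "hausdorff d S U \<le> hausdorff d S T + hausdorff d T U"
      using S T U by (intro hausdorff_triangle triangle) auto
    then show ?thesis using 3 by (simp add: capped_hausdorff_def)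
  qed
qed

lemma capped_hausdorff_root_set_le_fin_dist:
  assumes "U \<in> fin_sets X" "V \<in> fin_sets X"
  shows "capped_hausdorff (root_set X U) (root_set X V) \<le> d\<^sub>F U V"
proof (cases "U = {apex X} \<or> V = {apex X}")
  case True
  \<comment> \<open>If exactly one set is \<open>{apex X}\<close>, the left side of the goal is
    \<open>M\<close>; if both are, it is 0.\<close>
  then have "M \<le> d\<^sub>F U V" if "U \<noteq> V"
    using that M_le_fin_dist_apex assms fin_dist_commute by metis
  then show ?thesis
    using True fin_dist_nonneg[OF assms] assms root_set_empty_iff[of _ X]
    by (auto simp: capped_hausdorff_def)
next
  case False
  then show ?thesis
    using hausdorff_root_set_le_fin_dist[OF assms] by (simp add: capped_hausdorff_def root_set_empty_iff assms)
qed

section \<open>The quotient pseudometric\<close>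

abbreviation "linked \<equiv> glue_chain (same_mult X) d\<^sub>F"

lemma quot_dist_eq:
  assumes "\<alpha> \<in> mult_quot X" "\<beta> \<in> mult_quot X"
  shows "d\<^sub>G \<alpha> \<beta> = Inf {L. \<exists>a\<in>\<alpha>. \<exists>b\<in>\<beta>. linked a b L}"
proof -
  have "{chain_length d\<^sub>F n a p q b | n a b p q.
      a \<in> \<alpha> \<and> b \<in> \<beta> \<and> (\<forall>i\<in>{1..n}. (p i, q i) \<in> same_mult X)} =
    {L. \<exists>a\<in>\<alpha>. \<exists>b\<in>\<beta>. linked a b L}"
    unfolding glue_chain_iff by blast
  then show ?thesis using assms by (simp add: quot_dist_def)
qed

lemma mult_quot_nonempty: "\<alpha> \<in> mult_quot X \<Longrightarrow> \<alpha> \<noteq> {}"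
  unfolding mult_quot_def by (rule in_quotient_imp_non_empty[OF equiv_same_mult])

text \<open>Together with \<open>quot_dist_le\<close> this replaces reasoning about
  \<open>Inf\<close>. The set of lengths is non-empty because one leg already joins any two
  representatives.\<close>

lemma quot_dist_greatest:
  assumes "\<alpha> \<in> mult_quot X" "\<beta> \<in> mult_quot X"
    and "\<And>a b L. a \<in> \<alpha> \<Longrightarrow> b \<in> \<beta> \<Longrightarrow> linked a b L \<Longrightarrow> c \<le> L"
  shows "c \<le> d\<^sub>G \<alpha> \<beta>"
  unfolding quot_dist_eq[OF assms(1,2)]
proof (rule cInf_greatest)
  show "{L. \<exists>a\<in>\<alpha>. \<exists>b\<in>\<beta>. linked a b L} \<noteq> {}"
    using mult_quot_nonempty[OF assms(1)] mult_quot_nonempty[OF assms(2)]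
      glue_chain.direct[of "same_mult X" d\<^sub>F] by blast
qed (use assms(3) in blast)

text \<open>Bounds the lengths below, as the use of \<open>Inf\<close> in
  \<open>quot_dist_le\<close> requires.\<close>

lemma linked_nonneg:
  assumes "linked a b L" "a \<in> fin_sets X" "b \<in> fin_sets X"
  shows "0 \<le> L"
  by (rule glue_chain_lower_bound[OF assms, of "\<lambda>_ _. 0"])
    (auto simp: same_mult_def fin_dist_nonneg)

lemma quot_dist_le:
  assumes "\<alpha> \<in> mult_quot X" "\<beta> \<in> mult_quot X" "a \<in> \<alpha>" "b \<in> \<beta>" "linked a b L"
  shows "d\<^sub>G \<alpha> \<beta> \<le> L"
  unfolding quot_dist_eq[OF assms(1,2)]
proof (rule cInf_lower)
  show "bdd_below {L. \<exists>a\<in>\<alpha>. \<exists>b\<in>\<beta>. linked a b L}"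
    using assms by (auto intro!: bdd_belowI[of _ 0] elim!: linked_nonneg intro: mult_quot_subset)
qed (use assms in blast)

lemma quot_dist_nonneg: "0 \<le> d\<^sub>G \<alpha> \<beta>"
proof (cases "\<alpha> \<in> mult_quot X \<and> \<beta> \<in> mult_quot X")
  case True
  then show ?thesis by (auto intro!: quot_dist_greatest elim!: linked_nonneg intro: mult_quot_subset)
qed (auto simp: quot_dist_def)

lemma quot_dist_commute: "d\<^sub>G \<alpha> \<beta> = d\<^sub>G \<beta> \<alpha>"
proof -
  have le: "d\<^sub>G \<alpha> \<beta> \<le> d\<^sub>G \<beta> \<alpha>" if "\<alpha> \<in> mult_quot X" "\<beta> \<in> mult_quot X" for \<alpha> \<beta>
  proof (rule quot_dist_greatest[OF that(2,1)])
    fix b a L assume ab: "b \<in> \<beta>" "a \<in> \<alpha>" and "linked b a L"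
    then have "linked a b L"
      using that by (auto intro: glue_chain_sym[OF _ _ _ equiv_same_mult fin_dist_commute]
        mult_quot_subset)
    then show "d\<^sub>G \<alpha> \<beta> \<le> L" using quot_dist_le that ab by blast
  qed
  show ?thesis
    using le[of \<alpha> \<beta>] le[of \<beta> \<alpha>] by (auto simp: quot_dist_def intro: antisym)
qed

lemma quot_dist_self:
  assumes "\<alpha> \<in> mult_quot X"
  shows "d\<^sub>G \<alpha> \<alpha> = 0"
proof -
  obtain a where a: "a \<in> \<alpha>" using mult_quot_nonempty assms by blast
  then have "linked a a 0"
    using glue_chain.direct[of "same_mult X" d\<^sub>F a a] fin_dist_self[OF mult_quot_subset[OF assms a]]
    by simp
  then show ?thesis
    using quot_dist_le[OF assms assms a a] quot_dist_nonneg[of \<alpha> \<alpha>] by (blast intro: antisym)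
qed

lemma quot_dist_triangle:
  assumes "\<alpha> \<in> mult_quot X" "\<beta> \<in> mult_quot X" "\<gamma> \<in> mult_quot X"
  shows "d\<^sub>G \<alpha> \<gamma> \<le> d\<^sub>G \<alpha> \<beta> + d\<^sub>G \<beta> \<gamma>"
proof -
  \<comment> \<open>Moving terms across lets each infimum on the right be treated in turn as a
    greatest lower bound.\<close>
  have "d\<^sub>G \<alpha> \<gamma> - d\<^sub>G \<beta> \<gamma> \<le> d\<^sub>G \<alpha> \<beta>"
  proof (rule quot_dist_greatest[OF assms(1,2)])
    fix a b L assume L: "a \<in> \<alpha>" "b \<in> \<beta>" "linked a b L"
    have "d\<^sub>G \<alpha> \<gamma> - L \<le> d\<^sub>G \<beta> \<gamma>"
    proof (rule quot_dist_greatest[OF assms(2,3)])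
      fix b' c L' assume L': "b' \<in> \<beta>" "c \<in> \<gamma>" "linked b' c L'"
      \<comment> \<open>The two chains may meet \<open>\<beta>\<close> in different representatives;
        one extra gluing joins them at no cost.\<close>
      have "(b, b') \<in> same_mult X"
        using quotient_eq_iff[OF equiv_same_mult] assms L L' unfolding mult_quot_def by metis
      then have "linked a c (L + L')" using glue_chain_append L L' by metis
      then have "d\<^sub>G \<alpha> \<gamma> \<le> L + L'" using quot_dist_le assms L L' by blast
      then show "d\<^sub>G \<alpha> \<gamma> - L \<le> L'" by simp
    qed
    then show "d\<^sub>G \<alpha> \<gamma> - d\<^sub>G \<beta> \<gamma> \<le> L" by simp
  qed
  then show ?thesis by simp
qed

section \<open>Agreement of \<open>d\<^sub>G\<close> with the Hausdorff metric on finite subsets of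
  \<open>X\<close>\<close>

lemma quot_dist_mult_class:
  assumes S: "finite S" "S \<noteq> {}" "S \<subseteq> X" and T: "finite T" "T \<noteq> {}" "T \<subseteq> X"
  shows "d\<^sub>G (mult_class X (mult_pt X 1 ` S)) (mult_class X (mult_pt X 1 ` T)) = hausdorff d S T"
proof -
  let ?S = "mult_pt X 1 ` S" and ?T = "mult_pt X 1 ` T"
  let ?\<rho> = "\<lambda>U V. capped_hausdorff (root_set X U) (root_set X V)"
  have mem: "?S \<in> fin_sets X" "?T \<in> fin_sets X"
    using mult_pt_1_image_in_fin_sets assms by auto
  then have quot: "mult_class X ?S \<in> mult_quot X" "mult_class X ?T \<in> mult_quot X"
    by (auto simp: mult_class_def mult_quot_def intro: quotientI)
  have self: "?S \<in> mult_class X ?S" "?T \<in> mult_class X ?T"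
    using mem by (auto simp: mult_class_def same_mult_def)
  \<comment> \<open>The map sending \<open>x\<close> to \<open>mult_pt X 1 x\<close> is isometric,
    so the one-leg chain gives the upper bound.\<close>
  have "d\<^sub>F ?S ?T = hausdorff d S T"
    unfolding fin_dist_def using S T by (intro hausdorff_image) (auto simp: cone_dist_mult_pt subset_iff)
  then have upper: "d\<^sub>G (mult_class X ?S) (mult_class X ?T) \<le> hausdorff d S T"
    using quot_dist_le[OF quot self] glue_chain.direct by metis
  have lower: "hausdorff d S T \<le> d\<^sub>G (mult_class X ?S) (mult_class X ?T)"
  proof (rule quot_dist_greatest[OF quot])
    fix a b L assume ab: "a \<in> mult_class X ?S" "b \<in> mult_class X ?T" and L: "linked a b L"
    have "root_set X a = S" "root_set X b = T"
      using ab same_mult_root_set root_set_mult_pt_1_image[OF S] root_set_mult_pt_1_image[OF T]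
      unfolding mult_class_def by (metis Image_singleton_iff)+
    then have "hausdorff d S T = ?\<rho> a b" using assms by (simp add: capped_hausdorff_def)
    also have "\<dots> \<le> L"
    proof (rule glue_chain_lower_bound[OF L])
      show "a \<in> fin_sets X" "b \<in> fin_sets X" using ab quot mult_quot_subset by blast+
      show "same_mult X \<subseteq> fin_sets X \<times> fin_sets X" by (auto simp: same_mult_def)
      show "?\<rho> U V \<le> d\<^sub>F U V" if "U \<in> fin_sets X" "V \<in> fin_sets X" for U V
        using capped_hausdorff_root_set_le_fin_dist that .
      show "?\<rho> U W \<le> ?\<rho> U V + ?\<rho> V W"
        if "U \<in> fin_sets X" "V \<in> fin_sets X" "W \<in> fin_sets X" for U V W
        using that by (intro capped_hausdorff_triangle finite_root_set root_set_subset)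
      show "?\<rho> U V \<le> 0" if "(U, V) \<in> same_mult X" for U V
        unfolding same_mult_root_set[OF that]
        using that by (simp add: same_mult_def capped_hausdorff_self finite_root_set root_set_subset)
    qed
    finally show "hausdorff d S T \<le> L" .
  qed
  show ?thesis using upper lower by (rule antisym)
qed

section \<open>The uniformly discrete case\<close>

lemma fin_dist_uniformly_discrete:
  assumes "\<And>x z. x \<in> X \<Longrightarrow> z \<in> X \<Longrightarrow> x \<noteq> z \<Longrightarrow> \<eta> \<le> d x z"
    and "U \<in> fin_sets X" "V \<in> fin_sets X" "U \<noteq> V"
  shows "min M \<eta> \<le> d\<^sub>F U V"
  unfolding fin_dist_def
proof (rule hausdorff_uniformly_discrete)
  fix u v assume uv: "u \<in> U" "v \<in> V" "u \<noteq> v"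
  then have "u \<in> cone X" "v \<in> cone X" using assms fin_sets_subset_cone nonempty by blast+
  then obtain x z r t where x: "x \<in> X" "z \<in> X" "u = mult_pt X r x" "v = mult_pt X t z"
    by (auto simp: cone_eq)
  show "min M \<eta> \<le> d\<^sub>A u v"
  proof (cases "r = t")
    case True
    \<comment> \<open>With \<open>r = t = 0\<close> both points would be the apex, contrary to
      \<open>u \<noteq> v\<close>.\<close>
    then have "0 < t" "x \<noteq> z" using uv(3) mult_pt_eq_iff[OF x(1,2), of r t] x(3,4) by auto
    then have "1 * d x z \<le> real t * d x z" by (intro mult_right_mono) auto
    then show ?thesis using assms(1)[OF x(1,2) \<open>x \<noteq> z\<close>] x True by (simp add: cone_dist_mult_pt)
  next
    case False
    \<comment> \<open>Distinct naturals differ by at least 1.\<close>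
    then have "M * 1 \<le> M * \<bar>real t - real r\<bar>" using M_pos by (intro mult_left_mono) auto
    moreover have "0 \<le> real (min r t) * d x z" by simp
    ultimately show ?thesis unfolding x cone_dist_mult_pt[OF x(1,2)] by linarith
  qed
qed (use assms fin_setsD[of U] fin_setsD[of V] in auto)

lemma quot_dist_uniformly_discrete:
  assumes discrete: "\<And>x z. x \<in> X \<Longrightarrow> z \<in> X \<Longrightarrow> x \<noteq> z \<Longrightarrow> \<eta> \<le> d x z" and "0 < \<eta>"
    and quot: "\<alpha> \<in> mult_quot X" "\<beta> \<in> mult_quot X" "\<alpha> \<noteq> \<beta>"
  shows "min M \<eta> \<le> d\<^sub>G \<alpha> \<beta>"
proof (rule quot_dist_greatest[OF quot(1,2)])
  fix a b L assume ab: "a \<in> \<alpha>" "b \<in> \<beta>" and L: "linked a b L"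
  let ?\<rho> = "\<lambda>U V. if (U, V) \<in> same_mult X then 0 else min M \<eta>"
  have "(a, b) \<notin> same_mult X"
    using quotient_eq_iff[OF equiv_same_mult] quot ab unfolding mult_quot_def by metis
  then have "min M \<eta> = ?\<rho> a b" by simp
  also have "\<dots> \<le> L"
  proof (rule glue_chain_lower_bound[OF L])
    show "a \<in> fin_sets X" "b \<in> fin_sets X" using ab quot mult_quot_subset by blast+
    show "same_mult X \<subseteq> fin_sets X \<times> fin_sets X" by (auto simp: same_mult_def)
    show "?\<rho> U V \<le> d\<^sub>F U V" if "U \<in> fin_sets X" "V \<in> fin_sets X" for U V
      using that fin_dist_uniformly_discrete[OF discrete that] fin_dist_nonneg[OF that]
      by (auto simp: same_mult_def)
    \<comment> \<open>If both terms on the right vanish, transitivity of \<open>same_mult X\<close>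
      makes the left side vanish too.\<close>
    show "?\<rho> U W \<le> ?\<rho> U V + ?\<rho> V W" for U V W
      using \<open>0 < \<eta>\<close> M_pos by (auto simp: same_mult_def)
  qed simp
  finally show "min M \<eta> \<le> L" .
qed

end

text \<open>Once its terms are closer than \<open>\<epsilon>\<close>, a Cauchy sequence is constant.
  Here \<open>M\<close> is the carrier of the locale, not the constant of the cone.\<close>

lemma (in Metric_space) mcomplete_uniformly_discrete:
  assumes "0 < \<epsilon>" "\<And>x y. x \<in> M \<Longrightarrow> y \<in> M \<Longrightarrow> x \<noteq> y \<Longrightarrow> \<epsilon> \<le> d x y"
  shows "mcomplete"
  unfolding mcomplete_def
proof (intro allI impI)
  fix \<sigma> assume \<sigma>: "MCauchy \<sigma>"
  then obtain N where N: "\<And>n n'. N \<le> n \<Longrightarrow> N \<le> n' \<Longrightarrow> d (\<sigma> n) (\<sigma> n') < \<epsilon>"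
    using \<open>0 < \<epsilon>\<close> unfolding MCauchy_def by blast
  have mem: "\<sigma> n \<in> M" for n using \<sigma> by (auto simp: MCauchy_def)
  have "\<sigma> n = \<sigma> N" if "N \<le> n" for n
    using N[OF that order.refl] assms(2)[OF mem mem, of n N] by force
  then have "\<forall>\<^sub>F n in sequentially. \<sigma> n = \<sigma> N" unfolding eventually_sequentially by blast
  then have "limitin mtopology \<sigma> (\<sigma> N) sequentially"
    using mem by (auto simp: limitin_metric elim!: eventually_mono)
  then show "\<exists>x. limitin mtopology \<sigma> x sequentially" by blast
qed

theorem corollary14:
  fixes X :: "'a set" and d :: "'a \<Rightarrow> 'a \<Rightarrow> real" and M :: real
  assumes metric: "Metric_space X d"
    and bounded: "Metric_space.mbounded X d X"
    and nontrivial: "\<exists>x\<in>X. \<exists>y\<in>X. x \<noteq> y"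
    and M_pos: "M > 0"
    and theta: "sup_dist X d / M \<le> 2"
  shows "(\<forall>S T. finite S \<and> S \<noteq> {} \<and> S \<subseteq> X \<and> finite T \<and> T \<noteq> {} \<and> T \<subseteq> X \<longrightarrow>
            quot_dist X d M (mult_class X (mult_pt X 1 ` S)) (mult_class X (mult_pt X 1 ` T))
              = hausdorff d S T)
       \<and> ((\<exists>\<alpha>>0. \<forall>x\<in>X. \<forall>z\<in>X. x \<noteq> z \<longrightarrow> d x z \<ge> \<alpha>) \<longrightarrow>
            Metric_space (mult_quot X) (quot_dist X d M) \<and>
            Metric_space.mcomplete (mult_quot X) (quot_dist X d M))
       \<and> (\<forall>e\<in>multisets X. \<forall>f\<in>multisets X. e \<noteq> {apex X} \<and> f \<noteq> {apex X} \<longrightarrow>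
            fin_dist X d M e f \<ge> hausdorff d (root_set X e) (root_set X f))"
proof -
  interpret Metric_space X d by (rule metric)
  have "d x y \<le> 2 * M" if "x \<in> X" "y \<in> X" for x y
  proof -
    obtain B where "\<forall>x\<in>X. \<forall>y\<in>X. d x y \<le> B" using bounded mbounded_alt by blast
    \<comment> \<open>Boundedness makes \<open>sup_dist X d\<close> a genuine upper bound for
      \<open>d\<close>.\<close>
    then have "bdd_above ((\<lambda>(x, y). d x y) ` (X \<times> X))" by (intro bdd_aboveI[of _ B]) auto
    then have "d x y \<le> sup_dist X d"
      unfolding sup_dist_def using that cSUP_upper[of "(x, y)" "X \<times> X" "\<lambda>(x, y). d x y"] by simp
    also have "\<dots> \<le> 2 * M" using theta M_pos by (simp add: divide_simps)
    finally show ?thesis .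
  qed
  then interpret bounded_cone X d M
    using M_pos nontrivial by unfold_locales auto
  have complete: "Metric_space (mult_quot X) d\<^sub>G \<and> Metric_space.mcomplete (mult_quot X) d\<^sub>G"
    if "0 < \<eta>" "\<forall>x\<in>X. \<forall>z\<in>X. x \<noteq> z \<longrightarrow> d x z \<ge> \<eta>" for \<eta>
  proof -
    have discrete: "min M \<eta> \<le> d\<^sub>G \<alpha> \<beta>"
      if "\<alpha> \<in> mult_quot X" "\<beta> \<in> mult_quot X" "\<alpha> \<noteq> \<beta>" for \<alpha> \<beta>
      using quot_dist_uniformly_discrete[of \<eta> \<alpha> \<beta>] \<open>0 < \<eta>\<close> \<open>\<forall>x\<in>X. _\<close> that by blast
    interpret G: Metric_space "mult_quot X" d\<^sub>G
    proof
      show "d\<^sub>G \<alpha> \<beta> = 0 \<longleftrightarrow> \<alpha> = \<beta>" if "\<alpha> \<in> mult_quot X" "\<beta> \<in> mult_quot X" for \<alpha> \<beta>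
        \<comment> \<open>Distinct classes are separated by the positive number
          \<open>min M \<eta>\<close>.\<close>
        using discrete[OF that] quot_dist_self that \<open>0 < \<eta>\<close> M_pos by force
    qed (use quot_dist_nonneg quot_dist_commute quot_dist_triangle in auto)
    show ?thesis
      using G.Metric_space_axioms G.mcomplete_uniformly_discrete[OF _ discrete] \<open>0 < \<eta>\<close> M_pos
      by simp
  qed
  \<comment> \<open>The third claim is the case of multisets in
    \<open>hausdorff_root_set_le_fin_dist\<close>.\<close>
  have "multisets X \<subseteq> fin_sets X" by (auto simp: multisets_def)
  then show ?thesis
    by (intro conjI allI ballI impI; (elim exE conjE)?)
      (auto simp del: One_nat_def intro: quot_dist_mult_class
        hausdorff_root_set_le_fin_dist dest: complete)
qed

end
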